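(* Let $\mathcal{A}_n(\mathbf{x})=\sum_{T}\prod_{i=1}^nx_{d_T(i)}$, the sum being over all rooted trees $T$ on the vertex set $[n]$, where $d_T(i)$ is the in-degree of $i$ (edges oriented towards the root), and let $\mathfrak{A}_n(\mathbf{x})=\sum_{\mathfrak{a}}\prod_{i=1}^nx_{d_{\mathfrak{a}}(i)}$, the sum being over all (non-rooted) trees $\mathfrak{a}$ on the vertex set $[n]$, where $d_{\mathfrak{a}}(i)$ is the degree of $i$ in $\mathfrak{a}$. Let $\mathscr{D}=\sum_{k\ge0}x_{k+1}\partial_k$, where $\partial_k=\partial/\partial x_k$. Then $$\mathcal{A}_n(x_0,x_1,\dots,x_{n-1})=\mathscr{D}^{\,n-1}x_0^n\quad(n\ge1),\qquad \mathfrak{A}_n(x_1,x_2,\dots,x_{n-1})=\mathscr{D}^{\,n-2}x_1^n\quad(n\ge2).$$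
   Context: $[n]=\{1,\dots,n\}$; trees are labelled and non-plane. $\mathscr{D}$ acts on polynomials in $x_0,x_1,x_2,\dots$, and $\mathscr{D}^0$ is the identity. *)

theory Defs
  imports "HOL-Library.Poly_Mapping"
begin

section \<open>Labelled trees\<close>

text \<open>
  A simple graph on a vertex set \<open>V\<close> is given by its set \<open>E\<close> of edges, each of them a
  two-element subset of \<open>V\<close>.  The notion \<open>tree\<close> of the AFP entry \<open>Graph_Theory\<close>
  does not fit: it excludes directed cycles, and \<open>u, v, u\<close> is one in any symmetric digraph
  with an edge between \<open>u\<close> and \<open>v\<close>.
\<close>

definition simple_graph :: "'v set \<Rightarrow> 'v set set \<Rightarrow> bool" where
  "simple_graph V E \<longleftrightarrow> (\<forall>e\<in>E. \<exists>u\<in>V. \<exists>v\<in>V. u \<noteq> v \<and> e = {u, v})"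

definition graph_path :: "'v set \<Rightarrow> 'v set set \<Rightarrow> 'v list \<Rightarrow> bool" where
  "graph_path V E p \<longleftrightarrow>
     p \<noteq> [] \<and> distinct p \<and> set p \<subseteq> V \<and> successively (\<lambda>u v. {u, v} \<in> E) p"

definition graph_connected :: "'v set \<Rightarrow> 'v set set \<Rightarrow> bool" where
  "graph_connected V E \<longleftrightarrow>
     (\<forall>u\<in>V. \<forall>v\<in>V. \<exists>p. graph_path V E p \<and> hd p = u \<and> last p = v)"

definition graph_cycle :: "'v set \<Rightarrow> 'v set set \<Rightarrow> 'v list \<Rightarrow> bool" where
  "graph_cycle V E p \<longleftrightarrow> graph_path V E p \<and> length p \<ge> 3 \<and> {last p, hd p} \<in> E"

definition tree_on :: "'v set \<Rightarrow> 'v set set \<Rightarrow> bool" where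
  "tree_on V E \<longleftrightarrow>
     V \<noteq> {} \<and> simple_graph V E \<and> graph_connected V E \<and> (\<nexists>p. graph_cycle V E p)"

definition degree_in :: "'v set set \<Rightarrow> 'v \<Rightarrow> nat" where
  "degree_in E v = card {e \<in> E. v \<in> e}"

text \<open>
  In a tree with root \<open>r\<close> the edge \<open>{u, v}\<close> is oriented from \<open>u\<close> to \<open>v\<close> if it is the first
  step of the path from \<open>u\<close> to \<open>r\<close>.
\<close>

definition arc_to_root :: "'v set \<Rightarrow> 'v set set \<Rightarrow> 'v \<Rightarrow> 'v \<Rightarrow> 'v \<Rightarrow> bool" where
  "arc_to_root V E r u v \<longleftrightarrow> (\<exists>p. graph_path V E (u # v # p) \<and> last (v # p) = r)"

definition in_degree_to_root :: "'v set \<Rightarrow> 'v set set \<Rightarrow> 'v \<Rightarrow> 'v \<Rightarrow> nat" where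
  "in_degree_to_root V E r v = card {u. arc_to_root V E r u v}"

definition trees_on :: "'v set \<Rightarrow> 'v set set set" where
  "trees_on V = {E. tree_on V E}"

definition rooted_trees_on :: "'v set \<Rightarrow> ('v set set \<times> 'v) set" where
  "rooted_trees_on V = {(E, r). tree_on V E \<and> r \<in> V}"

text \<open>\<open>\<A>\<^sub>n(x)\<close> and \<open>\<AA>\<^sub>n(x)\<close>, for an arbitrary sequence \<open>x\<close> in a commutative semiring:\<close>

definition rooted_tree_sum :: "nat \<Rightarrow> (nat \<Rightarrow> 'a::comm_semiring_1) \<Rightarrow> 'a" where
  "rooted_tree_sum n x =
     (\<Sum>(E, r)\<in>rooted_trees_on {1..n}. \<Prod>i\<in>{1..n}. x (in_degree_to_root {1..n} E r i))"

definition tree_sum :: "nat \<Rightarrow> (nat \<Rightarrow> 'a::comm_semiring_1) \<Rightarrow> 'a" where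
  "tree_sum n x = (\<Sum>E\<in>trees_on {1..n}. \<Prod>i\<in>{1..n}. x (degree_in E i))"

lemma simple_graph_subset: "simple_graph V E \<Longrightarrow> E \<subseteq> Pow V"
  unfolding simple_graph_def by fastforce

lemma finite_trees_on:
  assumes "finite V"
  shows "finite (trees_on V)"
proof (rule finite_subset)
  show "trees_on V \<subseteq> Pow (Pow V)"
    using simple_graph_subset by (fastforce simp: trees_on_def tree_on_def)
qed (use assms in simp)

lemma finite_rooted_trees_on:
  assumes "finite V"
  shows "finite (rooted_trees_on V)"
proof (rule finite_subset)
  show "rooted_trees_on V \<subseteq> trees_on V \<times> V"
    by (auto simp: rooted_trees_on_def trees_on_def)
qed (use assms finite_trees_on in blast)

lemma in_degree_to_root_less:
  assumes "finite V" "v \<in> V"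
  shows "in_degree_to_root V E r v < card V"
proof -
  have "{u. arc_to_root V E r u v} \<subset> V"
    using assms by (auto simp: arc_to_root_def graph_path_def)
  then show ?thesis
    unfolding in_degree_to_root_def by (rule psubset_card_mono[OF assms(1)])
qed

lemma degree_in_less:
  assumes "finite V" "v \<in> V" "simple_graph V E"
  shows "degree_in E v < card V"
proof -
  have "{e \<in> E. v \<in> e} \<subseteq> (\<lambda>u. {u, v}) ` (V - {v})"
    using assms(3) by (fastforce simp: simple_graph_def insert_commute)
  then have "degree_in E v \<le> card (V - {v})"
    unfolding degree_in_def using assms(1) surj_card_le by blast
  also have "\<dots> < card V"
    using assms by (intro psubset_card_mono) auto
  finally show ?thesis .
qed

lemma degree_in_pos:
  assumes "finite V" "card V \<ge> 2" "v \<in> V" "tree_on V E"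
  shows "degree_in E v \<ge> 1"
proof -
  obtain w where w: "w \<in> V" "w \<noteq> v"
  proof -
    have "\<not> V \<subseteq> {v}"
      using assms(2) card_mono[of "{v}" V] by auto
    then show ?thesis using that by blast
  qed
  obtain p where p: "graph_path V E p" "hd p = v" "last p = w"
    using assms w unfolding tree_on_def graph_connected_def by blast
  then obtain u q where "p = v # u # q"
    using w by (cases p rule: remdups_adj.cases) (auto simp: graph_path_def)
  then have "{v, u} \<in> {e \<in> E. v \<in> e}"
    using p by (auto simp: graph_path_def)
  moreover have "finite E"
    using assms simple_graph_subset finite_subset[of E "Pow V"] by (auto simp: tree_on_def)
  ultimately show ?thesis
    unfolding degree_in_def using card_gt_0_iff[of "{e \<in> E. v \<in> e}"] by force
qed

text \<open>Only \<open>x\<^sub>0, \<dots>, x\<^bsub>n-1\<^esub>\<close> and \<open>x\<^sub>1, \<dots>, x\<^bsub>n-1\<^esub>\<close>, respectively, matter:\<close>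

lemma rooted_tree_sum_cong:
  assumes "\<And>k. k < n \<Longrightarrow> x k = y k"
  shows "rooted_tree_sum n x = rooted_tree_sum n y"
  unfolding rooted_tree_sum_def
proof (rule sum.cong[OF refl], clarify, rule prod.cong[OF refl])
  fix E r i assume "i \<in> {1..n}"
  then show "x (in_degree_to_root {1..n} E r i) = y (in_degree_to_root {1..n} E r i)"
    using assms in_degree_to_root_less[of "{1..n}" i E r] by simp
qed

lemma tree_sum_cong:
  assumes "n \<ge> 2" and "\<And>k. 1 \<le> k \<Longrightarrow> k < n \<Longrightarrow> x k = y k"
  shows "tree_sum n x = tree_sum n y"
  unfolding tree_sum_def
proof (intro sum.cong prod.cong refl)
  fix E i assume "E \<in> trees_on {1..n}" "i \<in> {1..n}"
  then show "x (degree_in E i) = y (degree_in E i)"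
    using assms degree_in_less[of "{1..n}" i E] degree_in_pos[of "{1..n}" i E]
    by (simp add: trees_on_def tree_on_def)
qed


section \<open>Polynomials in \<open>x\<^sub>0, x\<^sub>1, x\<^sub>2, \<dots>\<close>\<close>

text \<open>
  Finitely supported functions from exponent vectors to coefficients; multiplication on
  this type is convolution.
\<close>

type_synonym 'a polynomial = "(nat \<Rightarrow>\<^sub>0 nat) \<Rightarrow>\<^sub>0 'a"

definition indet :: "nat \<Rightarrow> 'a::comm_ring_1 polynomial" where
  "indet k = Poly_Mapping.single (Poly_Mapping.single k 1) 1"

text \<open>
  The subtraction of exponents is truncated, but only where the coefficient vanishes.
\<close>

definition partial_deriv :: "nat \<Rightarrow> 'a::comm_ring_1 polynomial \<Rightarrow> 'a polynomial" where
  "partial_deriv k p =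
     (\<Sum>m\<in>Poly_Mapping.keys p.
        Poly_Mapping.single (m - Poly_Mapping.single k 1)
          (of_nat (Poly_Mapping.lookup m k) * Poly_Mapping.lookup p m))"

text \<open>The sum is \<open>Sum_any\<close>; it has only finitely many nonzero terms, see below.\<close>

definition shift_deriv :: "'a::comm_ring_1 polynomial \<Rightarrow> 'a polynomial" where
  "shift_deriv p = (\<Sum>k. indet (Suc k) * partial_deriv k p)"

lemma partial_deriv_single:
  "partial_deriv k (Poly_Mapping.single m c) =
     Poly_Mapping.single (m - Poly_Mapping.single k 1) (of_nat (Poly_Mapping.lookup m k) * c)"
  by (simp add: partial_deriv_def)

lemma partial_deriv_eq_0:
  assumes "k \<notin> (\<Union>m\<in>Poly_Mapping.keys p. Poly_Mapping.keys m)"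
  shows "partial_deriv k p = 0"
  using assms unfolding partial_deriv_def
  by (intro sum.neutral) (auto simp: in_keys_iff)

lemma finite_shift_deriv_support: "finite {k. indet (Suc k) * partial_deriv k p \<noteq> 0}"
proof (rule finite_subset)
  show "{k. indet (Suc k) * partial_deriv k p \<noteq> 0}
      \<subseteq> (\<Union>m\<in>Poly_Mapping.keys p. Poly_Mapping.keys m)"
  proof
    fix k assume "k \<in> {k. indet (Suc k) * partial_deriv k p \<noteq> 0}"
    then have "partial_deriv k p \<noteq> 0" by auto
    then show "k \<in> (\<Union>m\<in>Poly_Mapping.keys p. Poly_Mapping.keys m)"
      using partial_deriv_eq_0 by blast
  qed
qed simp

end

theory Submission
  imports Defs "HOL-Library.Multiset"
begin

text \<open>
  Since \<open>\<D>\<close> is a derivation that raises one index by \<open>1\<close>, the polynomial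
  \<open>\<D>\<^sup>m (x\<^sub>a)\<^sup>n\<close> is the sum over all words \<open>xs\<close> of length \<open>m\<close> over \<open>[n]\<close> of the products
  of the \<open>x\<^bsub>a + c(i)\<^esub>\<close>, where \<open>c(i)\<close> is the number of occurrences of \<open>i\<close> in \<open>xs\<close>.  As in the
  Pruefer code, the words of length \<open>n - 2\<close> with \<open>1 + c = d\<close> are as many as the trees with degree
  function \<open>d\<close>: if \<open>l\<close> is some vertex with \<open>d(l) = 1\<close>, then deleting the leaf \<open>l\<close> and
  deleting the first letter of the word (the neighbour of \<open>l\<close>) lead to the same recursion.
  In a rooted tree the in-degree is the degree, less \<open>1\<close> unless the vertex is the root; so the
  root acts as one more letter, which gives the words of length \<open>n - 1\<close>.
\<close>

section \<open>Iterates of the derivation\<close>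

lemma prod_indet:
  "finite V \<Longrightarrow> (\<Prod>i\<in>V. indet (b i)) =
     (Poly_Mapping.single (\<Sum>i\<in>V. Poly_Mapping.single (b i) 1) 1 :: 'a::comm_ring_1 polynomial)"
  by (induction V rule: finite_induct) (simp_all add: indet_def mult_single flip: single_one)

text \<open>Gives \<open>p\<close>, \<open>q\<close> and \<open>p + q\<close> one common index set,
  so that additivity becomes a termwise identity although keys may cancel in the sum.\<close>

lemma partial_deriv_superset:
  assumes "finite S" "Poly_Mapping.keys p \<subseteq> S"
  shows "partial_deriv k p = (\<Sum>m\<in>S. Poly_Mapping.single (m - Poly_Mapping.single k 1)
          (of_nat (Poly_Mapping.lookup m k) * Poly_Mapping.lookup p m))"
  unfolding partial_deriv_def using assms
  by (intro sum.mono_neutral_left) (auto simp: in_keys_iff)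

lemma partial_deriv_add: "partial_deriv k (p + q) = partial_deriv k p + partial_deriv k q"
proof -
  have S: "finite (Poly_Mapping.keys p \<union> Poly_Mapping.keys q)" by simp
  show ?thesis
    using Poly_Mapping.keys_add[of p q]
    by (simp add: partial_deriv_superset[OF S] lookup_add distrib_left single_add sum.distrib)
qed

lemma shift_deriv_add: "shift_deriv (p + q) = shift_deriv p + shift_deriv q"
  unfolding shift_deriv_def partial_deriv_add distrib_left
  by (rule Sum_any.distrib) (rule finite_shift_deriv_support)+

lemma shift_deriv_0: "shift_deriv 0 = 0"
  by (simp add: shift_deriv_def partial_deriv_def)

lemma shift_deriv_sum: "shift_deriv (\<Sum>a\<in>A. f a) = (\<Sum>a\<in>A. shift_deriv (f a))"
  by (induction A rule: infinite_finite_induct) (simp_all add: shift_deriv_add shift_deriv_0)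

text \<open>The Leibniz rule in the only case required. The product is a single monomial whose
  exponent at \<open>k\<close> is the number of \<open>i\<close> with \<open>b i = k\<close>; the
  factor that \<open>partial_deriv k\<close> produces is therefore spent as one summand for each
  such \<open>i\<close>.\<close>

lemma shift_deriv_prod_indet:
  assumes "finite V"
  shows "shift_deriv (\<Prod>i\<in>V. indet (b i)) =
    (\<Sum>u\<in>V. \<Prod>i\<in>V. indet (b i + of_bool (i = u)) :: 'a::comm_ring_1 polynomial)"
proof -
  define m where "m = (\<Sum>i\<in>V. Poly_Mapping.single (b i) (1::nat))"
  \<comment> \<open>For \<open>k\<close> occurring in \<open>m\<close>, this is the monomial with
    one factor \<open>indet k\<close> replaced by \<open>indet (Suc k)\<close>.\<close>
  define t where "t k = (Poly_Mapping.single (Poly_Mapping.single (Suc k) 1 +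
    (m - Poly_Mapping.single k 1)) 1 :: 'a polynomial)" for k
  have lookup_m: "Poly_Mapping.lookup m k = card {i\<in>V. b i = k}" for k
    using assms by (simp add: m_def lookup_sum lookup_single when_def sum.If_cases Int_def)
  have term_eq: "indet (Suc k) * partial_deriv k (Poly_Mapping.single m 1) =
      (\<Sum>i\<in>{i\<in>V. b i = k}. t (b i))" for k
  proof -
    have "indet (Suc k) * partial_deriv k (Poly_Mapping.single m 1) = of_nat (card {i\<in>V. b i = k}) * t k"
      by (simp add: indet_def partial_deriv_single mult_single t_def lookup_m 
          flip: single_of_nat)
    then show ?thesis by simp
  qed
  have t_prod: "t (b u) = (\<Prod>i\<in>V. indet (b i + of_bool (i = u)))" if "u \<in> V" for u
  proof -
    \<comment> \<open>Splitting off the factor at \<open>u\<close> makes the truncated subtraction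
      in \<open>t\<close> exact.\<close>
    have m: "m = Poly_Mapping.single (b u) 1 + (\<Sum>i\<in>V-{u}. Poly_Mapping.single (b i) 1)"
      unfolding m_def using assms that by (rule sum.remove)
    show ?thesis
      unfolding prod_indet[OF assms] t_def m sum.remove[OF assms that]
      by (auto intro!: sum.cong arg_cong[where f = "\<lambda>m. Poly_Mapping.single m 1"])
  qed
  have "shift_deriv (\<Prod>i\<in>V. indet (b i)) = (\<Sum>k. \<Sum>i\<in>{i\<in>V. b i = k}. t (b i))"
    by (simp only: shift_deriv_def prod_indet[OF assms] term_eq flip: m_def)
  also have "\<dots> = (\<Sum>k\<in>b ` V. \<Sum>i\<in>{i\<in>V. b i = k}. t (b i))"
  proof (rule Sum_any.expand_superset)
    \<comment> \<open>For \<open>k\<close> outside the image of \<open>b\<close> the inner sum is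
      empty.\<close>
    show "{k. (\<Sum>i\<in>{i\<in>V. b i = k}. t (b i)) \<noteq> 0} \<subseteq> b ` V"
      by (blast elim: sum.not_neutral_contains_not_neutral)
  qed (use assms in simp)
  also have "\<dots> = (\<Sum>i\<in>V. t (b i))"
    using assms by (intro sum.group) auto
  also have "\<dots> = (\<Sum>u\<in>V. \<Prod>i\<in>V. indet (b i + of_bool (i = u)))"
    using t_prod by simp
  finally show ?thesis .
qed

lemma sum_lists_length_Suc:
  "(\<Sum>xs | set xs \<subseteq> V \<and> length xs = Suc m. f xs) =
   (\<Sum>xs | set xs \<subseteq> V \<and> length xs = m. \<Sum>u\<in>V. f (u # xs))"
  unfolding lists_length_Suc_eq sum.cartesian_product
  by (subst sum.reindex) (auto simp: inj_on_def intro!: sum.cong)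

text \<open>Each application of the derivation picks the factor whose index is raised;
  \<open>xs\<close> records the picks, the latest one first.\<close>

lemma shift_deriv_funpow_prod_indet:
  assumes "finite V"
  shows "(shift_deriv ^^ m) (\<Prod>i\<in>V. indet (b i)) =
    (\<Sum>xs | set xs \<subseteq> V \<and> length xs = m.
       \<Prod>i\<in>V. indet (b i + count_list xs i) :: 'a::comm_ring_1 polynomial)"
proof (induction m)
  case 0
  have "{xs. set xs \<subseteq> V \<and> length xs = 0} = {[]}" by auto
  then show ?case by simp
next
  case (Suc m)
  have Cons: "b i + count_list xs i + of_bool (i = u) = b i + count_list (u # xs) i" for xs i u
    by auto
  then show ?case
    using assms
    by (simp only: funpow.simps comp_apply Suc shift_deriv_sum shift_deriv_prod_indet
        sum_lists_length_Suc Cons)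
qed

section \<open>Paths, cycles and leaves\<close>

lemma graph_path_rev: "graph_path V E (rev p) \<longleftrightarrow> graph_path V E p"
  by (simp add: graph_path_def insert_commute)

lemma graph_path_append:
  "graph_path V E (p @ q) \<longleftrightarrow>
     (if p = [] then graph_path V E q else if q = [] then graph_path V E p else
      graph_path V E p \<and> graph_path V E q \<and> set p \<inter> set q = {} \<and> {last p, hd q} \<in> E)"
  by (auto simp: graph_path_def successively_append_iff)

lemma graph_path_mono:
  assumes "graph_path V E p" "V \<subseteq> V'" "E \<subseteq> E'"
  shows "graph_path V' E' p"
  using assms unfolding graph_path_def by (auto elim: successively_mono)

text \<open>Lets a cycle be read from any of its vertices.\<close>

lemma graph_cycle_rotate:
  assumes "graph_cycle V E (p @ q)"
  shows "graph_cycle V E (q @ p)"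
  using assms by (cases "p = []"; cases "q = []") (auto simp: graph_cycle_def graph_path_append)

lemma degree_in_eq_card_neighbours:
  assumes "simple_graph V E"
  shows "degree_in E v = card {u. {u, v} \<in> E}"
proof -
  have "bij_betw (\<lambda>u. {u, v}) {u. {u, v} \<in> E} {e \<in> E. v \<in> e}"
  proof (rule bij_betw_imageI)
    show "inj_on (\<lambda>u. {u, v}) {u. {u, v} \<in> E}"
      by (auto simp: inj_on_def doubleton_eq_iff)
    have "\<exists>u. e = {u, v}" if "e \<in> E" "v \<in> e" for e
    proof -
      obtain x y where "e = {x, y}" using \<open>e \<in> E\<close> assms by (auto simp: simple_graph_def)
      then show ?thesis using \<open>v \<in> e\<close> by auto
    qed
    then show "(\<lambda>u. {u, v}) ` {u. {u, v} \<in> E} = {e \<in> E. v \<in> e}"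
      by (auto simp: image_iff)
  qed
  then show ?thesis
    unfolding degree_in_def by (metis bij_betw_same_card)
qed

text \<open>The first vertex \<open>v\<close> of a longest path is a leaf. By maximality all
  neighbours of \<open>v\<close> lie on the path, and one beyond the second vertex would close a
  cycle; \<open>degree_in_pos\<close> excludes degree \<open>0\<close>.\<close>

lemma tree_has_leaf:
  assumes "finite V" "card V \<ge> 2" "tree_on V E"
  shows "\<exists>v\<in>V. degree_in E v = 1"
proof -
  let ?P = "\<lambda>p. graph_path V E p"
  obtain x where "x \<in> V" using assms by (auto simp: tree_on_def)
  then have "?P [x]" by (simp add: graph_path_def)
  moreover have "length p \<le> card V" if "?P p" for p
    using that assms(1) by (metis graph_path_def card_mono distinct_card)
  then have "\<forall>p. ?P p \<longrightarrow> length p < Suc (card V)" by (simp add: less_Suc_eq_le)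
  ultimately obtain p where p: "?P p" and max: "\<And>q. ?P q \<Longrightarrow> length q \<le> length p"
    using ex_has_greatest_nat[of ?P "[x]" length "Suc (card V)"] by blast
  obtain v q where pv: "p = v # q" using p by (cases p) (auto simp: graph_path_def)
  have v: "v \<in> V" using p pv by (auto simp: graph_path_def)
  have sg: "simple_graph V E" using assms by (simp add: tree_on_def)
  have nbr: "q \<noteq> [] \<and> u = hd q" if "{u, v} \<in> E" for u
  proof -
    have uv: "u \<in> V" "u \<noteq> v" using that sg by (auto simp: simple_graph_def doubleton_eq_iff)
    have "u \<in> set p"
    proof (rule ccontr)
      assume "u \<notin> set p"
      then have "?P (u # p)" using p pv that uv by (simp add: graph_path_def)
      then show False using max by fastforce
    qed
    then have "u \<in> set q" using uv pv by simp
    then obtain ys zs where q: "q = ys @ u # zs" by (meson split_list)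
    have "ys = []"
    proof (rule ccontr)
      assume ne: "ys \<noteq> []"
      have "?P ((v # ys @ [u]) @ zs)" using p pv q by simp
      then have "?P (v # ys @ [u])" unfolding graph_path_append by (auto split: if_splits)
      then have "graph_cycle V E (v # ys @ [u])"
        using ne that by (cases ys) (auto simp: graph_cycle_def)
      then show False using assms by (auto simp: tree_on_def)
    qed
    then show ?thesis using q by simp
  qed
  have "card {u. {u, v} \<in> E} \<le> card {hd q}"
    using nbr by (intro card_mono) auto
  then have "degree_in E v = 1"
    using degree_in_pos[OF assms(1,2) v assms(3)] degree_in_eq_card_neighbours[OF sg] by simp
  then show ?thesis using v by blast
qed

lemma tree_on_singleton: "tree_on {v} E \<longleftrightarrow> E = {}"
proof -
  have "\<not> graph_cycle {v} {} p" for p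
    by (auto simp: graph_cycle_def)
  moreover have "graph_path {v} {} [v]" by (simp add: graph_path_def)
  ultimately show ?thesis
    unfolding tree_on_def simple_graph_def graph_connected_def by fastforce
qed

section \<open>Attaching a pendant vertex \<open>l\<close> to a vertex \<open>u\<close>\<close>

context
  fixes V :: "'v set" and E :: "'v set set" and l u :: 'v
  assumes sg: "simple_graph V E" and u: "u \<in> V" and l: "l \<notin> V"
begin

lemma pendant_notin: "{x, l} \<notin> E" "{l, x} \<notin> E" "{x, l} \<in> insert {l, u} E \<longleftrightarrow> x = u"
    "{l, x} \<in> insert {l, u} E \<longleftrightarrow> x = u"
  using sg u l by (auto simp: simple_graph_def doubleton_eq_iff)

lemma simple_graph_pendant: "simple_graph (insert l V) (insert {l, u} E)"
  unfolding simple_graph_def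
proof
  fix e assume "e \<in> insert {l, u} E"
  then consider "e = {l, u}" | "e \<in> E" by blast
  then show "\<exists>x\<in>insert l V. \<exists>y\<in>insert l V. x \<noteq> y \<and> e = {x, y}"
  proof cases
    case 1
    then show ?thesis using u l by (intro bexI[of _ l] bexI[of _ u]) auto
  next
    case 2
    then obtain x y where "x \<in> V" "y \<in> V" "x \<noteq> y" "e = {x, y}"
      using sg unfolding simple_graph_def by blast
    then show ?thesis by blast
  qed
qed

lemma graph_path_avoiding_pendant:
  assumes "graph_path (insert l V) (insert {l, u} E) p" "l \<notin> set p"
  shows "graph_path V E p"
  using assms unfolding graph_path_def
  by (auto elim!: successively_mono simp: doubleton_eq_iff)

lemma graph_path_pendant: "graph_path V E p \<Longrightarrow> graph_path (insert l V) (insert {l, u} E) p"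
  by (rule graph_path_mono) auto

text \<open>The only neighbour of \<open>l\<close> is \<open>u\<close>, so an inner \<open>l\<close>
  would have \<open>u\<close> on both sides, and \<open>u\<close> would be repeated.\<close>

lemma pendant_not_inner:
  assumes "graph_path (insert l V) (insert {l, u} E) (xs @ l # ys)"
  shows "xs = [] \<or> ys = []"
proof (rule ccontr)
  assume ne: "\<not> (xs = [] \<or> ys = [])"
  then have "last xs = u" "hd ys = u"
    using assms by (auto simp: graph_path_append graph_path_append[of _ _ "[l]" ys, simplified]
        doubleton_eq_iff pendant_notin(1,2))
  then have "u \<in> set xs \<inter> set ys" using ne by (metis IntI last_in_set list.set_sel(1))
  then show False using assms by (auto simp: graph_path_def)
qed

text \<open>Read from \<open>l\<close>, such a cycle would have \<open>u\<close> both as its second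
  and as its last vertex; these are different entries because the length is at least 3.\<close>

lemma no_cycle_through_pendant:
  assumes "graph_cycle (insert l V) (insert {l, u} E) p"
  shows "l \<notin> set p"
proof
  assume "l \<in> set p"
  then obtain xs ys where "p = xs @ l # ys" by (meson split_list)
  then have c: "graph_cycle (insert l V) (insert {l, u} E) (l # ys @ xs)"
    using assms graph_cycle_rotate by fastforce
  define q where "q = ys @ xs"
  obtain a q' where q: "q = a # q'" "q' \<noteq> []"
    using c by (cases q; cases "tl q") (auto simp: graph_cycle_def q_def[symmetric])
  have "a = u" "last q' = u"
    using c q by (auto simp: graph_cycle_def graph_path_def pendant_notin q_def[symmetric])
  then show False
    using c q by (auto simp: graph_cycle_def graph_path_def q_def[symmetric])
qed

text \<open>Connectedness passes down because paths between vertices of \<open>V\<close> avoid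
  \<open>l\<close>, and up because \<open>l\<close> can be prepended to any path from
  \<open>u\<close>. Cycles never meet \<open>l\<close>, so both graphs have the same ones.\<close>

lemma tree_on_pendant: "tree_on (insert l V) (insert {l, u} E) \<longleftrightarrow> tree_on V E"
proof
  assume T: "tree_on (insert l V) (insert {l, u} E)"
  have "graph_connected V E"
    unfolding graph_connected_def
  proof (intro ballI)
    fix x y assume xy: "x \<in> V" "y \<in> V"
    then obtain p where p: "graph_path (insert l V) (insert {l, u} E) p" "hd p = x" "last p = y"
      using T unfolding tree_on_def graph_connected_def by blast
    have "l \<notin> set p"
    proof
      assume "l \<in> set p"
      then obtain xs ys where "p = xs @ l # ys" by (meson split_list)
      then show False using pendant_not_inner p xy l by fastforce
    qed
    then show "\<exists>p. graph_path V E p \<and> hd p = x \<and> last p = y"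
      using p graph_path_avoiding_pendant by blast
  qed
  moreover have "\<nexists>p. graph_cycle V E p"
    using T graph_path_pendant by (auto simp: tree_on_def graph_cycle_def)
  ultimately show "tree_on V E" using u sg by (auto simp: tree_on_def)
next
  assume T: "tree_on V E"
  then have conn: "\<exists>p. graph_path V E p \<and> hd p = x \<and> last p = y" if "x \<in> V" "y \<in> V" for x y
    using that by (simp add: tree_on_def graph_connected_def)
  let ?P = "graph_path (insert l V) (insert {l, u} E)"
  have from_l: "\<exists>p. ?P p \<and> hd p = l \<and> last p = y" if y: "y \<in> V" for y
  proof -
    obtain p where p: "graph_path V E p" "hd p = u" "last p = y"
      using conn[OF u y] by blast
    then have "?P (l # p)"
      using graph_path_pendant[OF p(1)] l by (cases p) (auto simp: graph_path_def)
    then show ?thesis using p by (intro exI[of _ "l # p"]) (auto simp: graph_path_def)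
  qed
  have "graph_connected (insert l V) (insert {l, u} E)"
    unfolding graph_connected_def
  proof (intro ballI)
    fix x y assume xy: "x \<in> insert l V" "y \<in> insert l V"
    consider "x = l" "y = l" | "x = l" "y \<in> V" | "x \<in> V" "y = l" | "x \<in> V" "y \<in> V"
      using xy by blast
    then show "\<exists>p. ?P p \<and> hd p = x \<and> last p = y"
    proof cases
      case 1
      then show ?thesis by (intro exI[of _ "[l]"]) (simp add: graph_path_def)
    next
      case 2
      then show ?thesis using from_l by blast
    next
      case 3
      then obtain p where "?P p" "hd p = l" "last p = x" using from_l by blast
      then show ?thesis
        using 3 by (intro exI[of _ "rev p"]) (simp add: graph_path_rev hd_rev last_rev)
    next
      case 4
      then show ?thesis
        using conn[of x y] graph_path_pendant by blast
    qed
  qed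
  moreover have "\<nexists>p. graph_cycle (insert l V) (insert {l, u} E) p"
  proof
    assume "\<exists>p. graph_cycle (insert l V) (insert {l, u} E) p"
    then obtain p where p: "graph_cycle (insert l V) (insert {l, u} E) p" ..
    have "l \<notin> set p" using p by (rule no_cycle_through_pendant)
    moreover have "p \<noteq> []" using p by (auto simp: graph_cycle_def)
    \<comment> \<open>Hence the closing edge of the cycle is not \<open>{l, u}\<close>
      either.\<close>
    ultimately have "last p \<noteq> l" "hd p \<noteq> l" by auto
    then have "graph_cycle V E p"
      using p \<open>l \<notin> set p\<close> graph_path_avoiding_pendant
      by (auto simp: graph_cycle_def doubleton_eq_iff)
    then show False using T by (auto simp: tree_on_def)
  qed
  ultimately show "tree_on (insert l V) (insert {l, u} E)"
    using simple_graph_pendant by (simp add: tree_on_def)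
qed

lemma degree_in_pendant:
  assumes "finite V"
  shows "degree_in (insert {l, u} E) v = degree_in E v + of_bool (v \<in> {l, u})"
proof -
  have "finite E" using simple_graph_subset[OF sg] assms finite_subset[of E "Pow V"] by simp
  then have card: "card (insert {l, u} {e \<in> E. v \<in> e}) = Suc (degree_in E v)"
    unfolding degree_in_def using pendant_notin(2) by (subst card_insert_disjoint) auto
  have "{e \<in> insert {l, u} E. v \<in> e} =
      (if v \<in> {l, u} then insert {l, u} {e \<in> E. v \<in> e} else {e \<in> E. v \<in> e})" by auto
  then show ?thesis
    using card by (simp add: degree_in_def)
qed

lemma degree_in_outside: "degree_in E l = 0"
proof -
  have "{e \<in> E. l \<in> e} = {}" using sg l by (auto simp: simple_graph_def)
  then show ?thesis unfolding degree_in_def by (metis card.empty)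
qed

end

section \<open>Trees with prescribed degrees\<close>

text \<open>Extracts only the shape of \<open>E\<close>; that \<open>F\<close> is again a tree is
  then supplied by \<open>tree_on_pendant\<close>.\<close>

lemma tree_on_remove_leaf:
  assumes "finite V" "tree_on V E" "l \<in> V" "degree_in E l = 1"
  obtains u F where "u \<in> V - {l}" "simple_graph (V - {l}) F" "E = insert {l, u} F"
proof -
  have sg: "simple_graph V E" using assms by (simp add: tree_on_def)
  obtain e where e: "{e \<in> E. l \<in> e} = {e}"
    using assms(4) unfolding degree_in_def by (metis card_1_singletonE)
  then have "e \<in> E" "l \<in> e" by auto
  then obtain u where u: "u \<in> V - {l}" "e = {l, u}"
    using sg unfolding simple_graph_def by fastforce
  have "simple_graph (V - {l}) (E - {e})"
    unfolding simple_graph_def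
  proof
    fix f assume f: "f \<in> E - {e}"
    then have "l \<notin> f" using e by auto
    moreover obtain x y where "x \<in> V" "y \<in> V" "x \<noteq> y" "f = {x, y}"
      using sg f unfolding simple_graph_def by blast
    ultimately show "\<exists>x\<in>V - {l}. \<exists>y\<in>V - {l}. x \<noteq> y \<and> f = {x, y}" by blast
  qed
  moreover have "E = insert {l, u} (E - {e})" using \<open>e \<in> E\<close> u by auto
  ultimately show thesis using that u by blast
qed

text \<open>Deleting the leaf \<open>l\<close> lowers the degree of its neighbour \<open>u\<close>
  by one and changes no other degree on \<open>V - {l}\<close>. The condition is written additively
  to avoid truncated subtraction.\<close>

lemma bij_betw_add_leaf:
  fixes d :: "'v \<Rightarrow> nat"
  assumes V: "finite V" and l: "l \<in> V" and d: "d l = 1"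
  shows "bij_betw (\<lambda>(u, F). insert {l, u} F)
     (SIGMA u : V - {l}. {F \<in> trees_on (V - {l}). \<forall>v\<in>V - {l}. degree_in F v + of_bool (v = u) = d v})
     {E \<in> trees_on V. \<forall>v\<in>V. degree_in E v = d v}"
  (is "bij_betw ?f ?A ?B")
proof (rule bij_betw_imageI)
  let ?W = "V - {l}"
  have V_eq: "insert l ?W = V" using l by auto
  show "inj_on ?f ?A"
  proof (rule inj_onI)
    fix p p' assume p: "p \<in> ?A" "p' \<in> ?A" "?f p = ?f p'"
    obtain u F u' F' where pp: "p = (u, F)" "p' = (u', F')" by force
    have F: "F \<in> trees_on ?W" "F' \<in> trees_on ?W" and u: "u \<noteq> l" "u' \<noteq> l"
      and eq: "insert {l, u} F = insert {l, u'} F'"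
      using p by (auto simp: pp)
    have sg: "simple_graph ?W F" "simple_graph ?W F'"
      using F by (auto simp: trees_on_def tree_on_def)
    then have notin: "{l, x} \<notin> F" "{l, x} \<notin> F'" for x
      by (fastforce simp: simple_graph_def doubleton_eq_iff)+
    \<comment> \<open>On each side this is the only edge that contains \<open>l\<close>.\<close>
    have "{l, u} = {l, u'}" using eq notin by blast
    then have "u = u'" using u by (auto simp: doubleton_eq_iff)
    then show "p = p'" using eq notin pp by (metis insert_ident)
  qed
  have tree: "tree_on V (insert {l, u} F) \<longleftrightarrow> tree_on ?W F"
    and deg: "degree_in (insert {l, u} F) v = degree_in F v + of_bool (v \<in> {l, u})"
    and deg_l: "degree_in F l = 0"
    if "simple_graph ?W F" "u \<in> ?W" for u F v
    using tree_on_pendant[OF that, of l] degree_in_pendant[OF that, of l v] V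
      degree_in_outside[OF that, of l] V_eq by auto
  show "?f ` ?A = ?B"
  proof (intro equalityI subsetI)
    fix E assume "E \<in> ?f ` ?A"
    then obtain u F where u: "u \<in> ?W" and F: "tree_on ?W F" and E: "E = insert {l, u} F"
      and dF: "\<And>v. v \<in> ?W \<Longrightarrow> degree_in F v + of_bool (v = u) = d v"
      by (auto simp: trees_on_def)
    have sg: "simple_graph ?W F" using F by (simp add: tree_on_def)
    have "degree_in E v = d v" if "v \<in> V" for v
      using that deg[OF sg u, of v] deg_l[OF sg u] E dF[of v] d by (cases "v = l") auto
    then show "E \<in> ?B" using tree[OF sg u] F E by (simp add: trees_on_def)
  next
    fix E assume "E \<in> ?B"
    then have E: "tree_on V E" and dE: "\<And>v. v \<in> V \<Longrightarrow> degree_in E v = d v"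
      by (auto simp: trees_on_def)
    then obtain u F where uF: "u \<in> ?W" "simple_graph ?W F" "E = insert {l, u} F"
      using tree_on_remove_leaf[OF V E l] d l by metis
    have "degree_in F v + of_bool (v = u) = d v" if "v \<in> ?W" for v
      using that deg[OF uF(2,1), of v] uF(3) dE[of v] by simp
    then have "(u, F) \<in> ?A" using uF E tree[OF uF(2,1)] by (simp add: trees_on_def)
    then show "E \<in> ?f ` ?A" using uF(3) by force
  qed
qed

text \<open>The counterpart of \<open>bij_betw_add_leaf\<close> for words: \<open>d l = 1\<close>
  says that \<open>l\<close> does not occur, and the first letter takes the role of the neighbour of
  \<open>l\<close>.\<close>

lemma bij_betw_Cons_count_list:
  fixes d :: "'v \<Rightarrow> nat"
  assumes l: "l \<in> V" "d l = 1"
  shows "bij_betw (\<lambda>(u, xs). u # xs)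
     (SIGMA u : V - {l}. {xs. set xs \<subseteq> V - {l} \<and> length xs = m
        \<and> (\<forall>v\<in>V - {l}. Suc (count_list xs v) + of_bool (v = u) = d v)})
     {xs. set xs \<subseteq> V \<and> length xs = Suc m \<and> (\<forall>v\<in>V. Suc (count_list xs v) = d v)}"
  (is "bij_betw ?f ?A ?B")
proof (rule bij_betw_imageI)
  show "inj_on ?f ?A" by (auto simp: inj_on_def)
  show "?f ` ?A = ?B"
  proof (intro equalityI subsetI)
    fix ys assume "ys \<in> ?f ` ?A"
    then obtain u xs where ys: "ys = u # xs" "u \<in> V - {l}" "set xs \<subseteq> V - {l}" "length xs = m"
      and d: "\<And>v. v \<in> V - {l} \<Longrightarrow> Suc (count_list xs v) + of_bool (v = u) = d v" by auto
    have "count_list xs l = 0" using ys by (auto simp: count_list_0_iff)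
    then have "Suc (count_list ys v) = d v" if "v \<in> V" for v
      using ys l d[of v] that by (cases "v = l"; cases "v = u") auto
    then show "ys \<in> ?B" using ys by auto
  next
    fix ys assume ys: "ys \<in> ?B"
    then obtain u xs where u: "ys = u # xs" by (cases ys) auto
    have "count_list ys l = 0" using ys l by auto
    then have "l \<notin> set ys" by (simp add: count_list_0_iff)
    moreover have "Suc (count_list xs v) + of_bool (v = u) = d v" if "v \<in> V" for v
      using ys u that by (cases "u = v") (auto simp del: One_nat_def)
    ultimately have "(u, xs) \<in> ?A" using ys u by auto
    then show "ys \<in> ?f ` ?A" using u by force
  qed
qed

text \<open>The two preceding bijections, used with the same \<open>l\<close>, give both sides the
  same recursion. \<open>V\<close> and \<open>d\<close> vary in the induction because the step
  removes \<open>l\<close> and lowers \<open>d\<close> at \<open>u\<close>. As only cardinalities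
  are compared, \<open>l\<close> can be chosen arbitrarily among the vertices with
  \<open>d l = 1\<close>.\<close>

lemma card_trees_with_degrees:
  assumes "finite V" "card V = m + 2"
  shows "card {E \<in> trees_on V. \<forall>v\<in>V. degree_in E v = d v} =
    card {xs. set xs \<subseteq> V \<and> length xs = m \<and> (\<forall>v\<in>V. Suc (count_list xs v) = d v)}"
  using assms
proof (induction m arbitrary: V d)
  case 0
  then obtain a b where ab: "V = {a, b}" "a \<noteq> b"
    by (auto simp: card_2_iff numeral_2_eq_2[symmetric])
  \<comment> \<open>The tree on two vertices is the one on \<open>b\<close> with the leaf
    \<open>a\<close> attached.\<close>
  have sg: "simple_graph {b} {}" by (simp add: simple_graph_def)
  have "trees_on V = {{{a, b}}}"
  proof (intro equalityI subsetI)
    fix E assume "E \<in> trees_on V"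
    then have E: "tree_on V E" by (simp add: trees_on_def)
    then have "E \<subseteq> {{a, b}}" using ab by (auto simp: tree_on_def simple_graph_def insert_commute)
    moreover have "E \<noteq> {}"
      using degree_in_pos[of V a E] 0 E ab by (auto simp: degree_in_def)
    ultimately show "E \<in> {{{a, b}}}" by blast
  next
    fix E assume "E \<in> {{{a, b}}}"
    then show "E \<in> trees_on V"
      using tree_on_pendant[OF sg, of b a] ab by (simp add: trees_on_def tree_on_singleton)
  qed
  moreover have "degree_in {{a, b}} v = 1" if "v \<in> V" for v
    using that ab degree_in_pendant[OF sg, of b a v] by (auto simp: degree_in_def)
  then have "(\<forall>v\<in>V. degree_in {{a, b}} v = d v) \<longleftrightarrow> (\<forall>v\<in>V. d v = 1)" by metis
  ultimately have "{E \<in> trees_on V. \<forall>v\<in>V. degree_in E v = d v} =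
      (if \<forall>v\<in>V. d v = 1 then {{{a, b}}} else {})"
    by auto
  moreover have "{xs. set xs \<subseteq> V \<and> length xs = 0 \<and> (\<forall>v\<in>V. Suc (count_list xs v) = d v)} =
      (if \<forall>v\<in>V. d v = 1 then {[]} else {})"
    by (force simp: eq_commute[of _ "d _"])
  ultimately show ?case by simp
next
  case (Suc m)
  show ?case
  proof (cases "\<exists>l\<in>V. d l = 1")
    \<comment> \<open>Both sets are empty: a tree has a leaf, and a word would have to contain all
      \<open>m + 3\<close> vertices among its \<open>m + 1\<close> letters.\<close>
    case False
    have no_tree: "\<not> (\<forall>v\<in>V. degree_in E v = d v)" if "E \<in> trees_on V" for E
    proof -
      have "tree_on V E" "card V \<ge> 2" using that Suc.prems by (auto simp: trees_on_def)
      then show ?thesis using tree_has_leaf[OF Suc.prems(1)] False by metis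
    qed
    have no_list: "\<not> (\<forall>v\<in>V. Suc (count_list xs v) = d v)"
      if "set xs \<subseteq> V" "length xs = Suc m" for xs
    proof
      assume d: "\<forall>v\<in>V. Suc (count_list xs v) = d v"
      have "V \<subseteq> set xs"
        using d False by (metis One_nat_def count_list_0_iff subsetI)
      then have "card V \<le> length xs"
        using card_mono[of "set xs" V] card_length[of xs] by simp
      then show False using Suc.prems that by simp
    qed
    have "{E \<in> trees_on V. \<forall>v\<in>V. degree_in E v = d v} = {}" using no_tree by blast
    moreover have "{xs. set xs \<subseteq> V \<and> length xs = Suc m \<and> (\<forall>v\<in>V. Suc (count_list xs v) = d v)} = {}"
      using no_list by blast
    ultimately show ?thesis by (simp only: card.empty)
  next
    case True
    then obtain l where l: "l \<in> V" "d l = 1" by blast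
    let ?W = "V - {l}"
    let ?F = "\<lambda>u. {F \<in> trees_on ?W. \<forall>v\<in>?W. degree_in F v + of_bool (v = u) = d v}"
    let ?X = "\<lambda>u. {xs. set xs \<subseteq> ?W \<and> length xs = m
        \<and> (\<forall>v\<in>?W. Suc (count_list xs v) + of_bool (v = u) = d v)}"
    have W: "finite ?W" "card ?W = m + 2" using Suc.prems l by auto
    have "card (?F u) = card (?X u)" if u: "u \<in> ?W" for u
    proof (cases "d u")
      \<comment> \<open>At \<open>v = u\<close> the condition would make a successor equal to
        \<open>0\<close>.\<close>
      case 0
      have "?F u = {}" "?X u = {}" using u 0 by auto
      then show ?thesis by (simp only: card.empty)
    next
      case (Suc k)
      \<comment> \<open>Lowering \<open>d\<close> by one at \<open>u\<close> absorbs the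
        \<open>of_bool\<close> term and yields the form of the induction hypothesis.\<close>
      let ?d = "d(u := k)"
      have eq: "(\<forall>v\<in>?W. f v + of_bool (v = u) = d v) \<longleftrightarrow> (\<forall>v\<in>?W. f v = ?d v)" for f
        using Suc by auto
      show ?thesis unfolding eq using Suc.IH[OF W] by simp
    qed
    moreover have "finite (?F u)" for u
      by (rule finite_subset[OF _ finite_trees_on[OF W(1)]]) blast
    moreover have "finite (?X u)" for u
      by (rule finite_subset[OF _ finite_lists_length_eq[OF W(1), of m]]) blast
    ultimately have "card (Sigma ?W ?F) = card (Sigma ?W ?X)"
      using W(1) by (simp add: card_SigmaI del: mem_Collect_eq)
    then show ?thesis
      using bij_betw_same_card[OF bij_betw_add_leaf[of V l d]] Suc.prems(1) l
        bij_betw_same_card[OF bij_betw_Cons_count_list[of l V d m]] by simp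
  qed
qed

section \<open>From counts of degree functions to weighted sums\<close>

lemma sum_cong_fibres:
  assumes "finite A" "finite B"
    and "\<And>c. card {a \<in> A. f a = c} = card {b \<in> B. g b = c}"
  shows "(\<Sum>a\<in>A. h (f a)) = (\<Sum>b\<in>B. h (g b))"
proof -
  have "count (image_mset f (mset_set A)) c = count (image_mset g (mset_set B)) c" for c
    using assms by (simp add: count_image_mset' eq_commute[of c] conj_commute)
  then have "image_mset f (mset_set A) = image_mset g (mset_set B)"
    by (rule multiset_eqI)
  then have "image_mset h (image_mset f (mset_set A)) = image_mset h (image_mset g (mset_set B))"
    by simp
  then show ?thesis
    by (simp add: sum_unfold_sum_mset multiset.map_comp comp_def)
qed

text \<open>The weight may depend on the vertex so that, for rooted trees, the root can be treated
  differently from the others.\<close>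

lemma sum_trees_degrees:
  fixes w :: "'v \<Rightarrow> nat \<Rightarrow> 'a::comm_semiring_1"
  assumes "finite V" "card V = m + 2"
  shows "(\<Sum>E\<in>trees_on V. \<Prod>v\<in>V. w v (degree_in E v)) =
    (\<Sum>xs | set xs \<subseteq> V \<and> length xs = m. \<Prod>v\<in>V. w v (Suc (count_list xs v)))"
proof -
  \<comment> \<open>Outside \<open>V\<close> a tree gives degree \<open>0\<close> but a word gives
    \<open>Suc 0\<close>. Resetting both to \<open>0\<close> makes the fibres depend on the values
    on \<open>V\<close> alone.\<close>
  let ?r = "\<lambda>f v. if v \<in> V then f v else (0::nat)"
  let ?h = "\<lambda>d. \<Prod>v\<in>V. w v (d v)"
  let ?A = "trees_on V" and ?B = "{xs. set xs \<subseteq> V \<and> length xs = m}"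
  have "(\<Sum>E\<in>?A. ?h (?r (degree_in E))) = (\<Sum>xs\<in>?B. ?h (?r (\<lambda>v. Suc (count_list xs v))))"
  proof (rule sum_cong_fibres[where h = ?h])
    fix d :: "'v \<Rightarrow> nat"
    \<comment> \<open>\<open>c\<close> is the part of the fibre condition that depends only on
      \<open>d\<close>; if it fails, both fibres are empty.\<close>
    obtain c where "c \<longleftrightarrow> (\<forall>v. v \<notin> V \<longrightarrow> d v = 0)" by blast
    then have r: "?r f = d \<longleftrightarrow> (\<forall>v\<in>V. f v = d v) \<and> c" for f
      by (auto simp: fun_eq_iff)
    show "card {E \<in> ?A. ?r (degree_in E) = d} =
        card {xs \<in> ?B. ?r (\<lambda>v. Suc (count_list xs v)) = d}"
      unfolding r using card_trees_with_degrees[OF assms, of d]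
      by (cases c) (auto simp: conj_assoc)
  qed (use assms finite_trees_on finite_lists_length_eq in auto)
  then show ?thesis by simp
qed

section \<open>In-degrees of rooted trees\<close>

text \<open>If both paths ended at the same vertex, one could follow the path from \<open>w\<close>
  to its first vertex \<open>z\<close> on the path from \<open>v\<close> and go back along the
  latter to \<open>v\<close>; the edge \<open>{v, w}\<close> would close a cycle.\<close>

lemma no_short_cut_in_tree:
  assumes "tree_on V E" "graph_path V E (v # q)" "graph_path V E (w # p)" "{v, w} \<in> E"
    "w \<notin> set q" "v \<notin> set p" "v \<noteq> w"
  shows "last (v # q) \<noteq> last (w # p)"
proof
  assume eq: "last (v # q) = last (w # p)"
  have "\<exists>x\<in>set (w # p). x \<in> set (v # q)"
    using last_in_set[of "w # p"] last_in_set[of "v # q"] eq by (metis list.distinct(1))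
  then obtain A z B where wp: "w # p = A @ z # B" and z: "z \<in> set (v # q)"
    and A: "\<forall>x\<in>set A. x \<notin> set (v # q)"
    by (rule split_list_first_propE)
  obtain C D where vq: "v # q = C @ z # D" using z by (meson split_list)
  \<comment> \<open>\<open>z\<close> differs from \<open>v\<close> and from \<open>w\<close>, so the
    cycle has at least three vertices.\<close>
  have "C \<noteq> []" using wp vq assms(6,7) by (cases C; cases A) auto
  then have hC: "hd C = v" using vq by (cases C) auto
  have "A \<noteq> []" using wp z assms(5,7) by (cases A) auto
  then have hA: "hd A = w" using wp by (cases A) auto
  have P1: "graph_path V E ((A @ [z]) @ B)" using assms(3) wp by simp
  have "graph_path V E ((C @ [z]) @ D)" using assms(2) vq by simp
  then have P2: "graph_path V E (C @ [z])" unfolding graph_path_append by (auto split: if_splits)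
  have P3: "graph_path V E (A @ [z])" using P1 unfolding graph_path_append by (auto split: if_splits)
  have "set A \<inter> set C = {}" using A vq by (metis Int_emptyI UnI1 set_append)
  then have "graph_path V E (A @ z # rev C)"
    using P2 P3 \<open>A \<noteq> []\<close> \<open>C \<noteq> []\<close>
    unfolding graph_path_append[of V E A] graph_path_append[of V E "[z]" "rev C", simplified]
      graph_path_append[of V E C] by (auto simp: graph_path_rev hd_rev insert_commute)
  moreover have "length (A @ z # rev C) \<ge> 3"
    using \<open>A \<noteq> []\<close> \<open>C \<noteq> []\<close> by (cases A; cases C) auto
  moreover have "last (A @ z # rev C) = v" "hd (A @ z # rev C) = w"
    using hC hA \<open>A \<noteq> []\<close> \<open>C \<noteq> []\<close> by (auto simp: last_rev)
  ultimately have "graph_cycle V E (A @ z # rev C)"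
    using assms(4) by (simp add: graph_cycle_def)
  then show False using assms(1) by (auto simp: tree_on_def)
qed

text \<open>All edges at the root point to it. At any other \<open>v\<close> exactly one edge points
  away, namely the one to the next vertex \<open>w\<close> on a path to the root.\<close>

lemma in_degree_to_root_eq:
  assumes "tree_on V E" "r \<in> V" "v \<in> V"
  shows "in_degree_to_root V E r v = (if v = r then degree_in E v else degree_in E v - 1)"
proof -
  have sg: "simple_graph V E" using assms by (simp add: tree_on_def)
  have nbr: "{x, y} \<in> E \<Longrightarrow> x \<in> V \<and> y \<in> V \<and> x \<noteq> y" for x y
    using sg by (auto simp: simple_graph_def doubleton_eq_iff)
  have arc_edge: "{x, v} \<in> E" if "arc_to_root V E r x v" for x
    using that by (auto simp: arc_to_root_def graph_path_def)
  show ?thesis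
  proof (cases "v = r")
    case True
    have "arc_to_root V E r x v" if "{x, v} \<in> E" for x
      unfolding arc_to_root_def using nbr[OF that] that True
      by (intro exI[of _ "[]"]) (simp add: graph_path_def)
    then have "{x. arc_to_root V E r x v} = {x. {x, v} \<in> E}" using arc_edge by blast
    then show ?thesis
      using True by (simp add: in_degree_to_root_def degree_in_eq_card_neighbours[OF sg])
  next
    case False
    obtain p' where p': "graph_path V E p'" "hd p' = v" "last p' = r"
      using assms unfolding tree_on_def graph_connected_def by blast
    then obtain w p where "p' = v # w # p"
      using False by (cases p' rule: remdups_adj.cases) (auto simp: graph_path_def)
    then have p: "graph_path V E (v # w # p)" "last (w # p) = r" using p' by auto
    have vw: "{v, w} \<in> E" using p by (simp add: graph_path_def)
    \<comment> \<open>Otherwise \<open>r\<close> would be reached from \<open>v\<close> avoiding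
      \<open>w\<close> and from \<open>w\<close> avoiding \<open>v\<close>.\<close>
    have "\<not> arc_to_root V E r w v"
    proof
      assume "arc_to_root V E r w v"
      then obtain q where q: "graph_path V E (w # v # q)" "last (v # q) = r"
        by (auto simp: arc_to_root_def)
      show False
        using no_short_cut_in_tree[of V E v q w p] assms p q vw by (auto simp: graph_path_def)
    qed
    \<comment> \<open>A further neighbour \<open>x\<close> of \<open>v\<close> on the path would
      close a cycle; so \<open>x\<close> can be put in front of it.\<close>
    moreover have "arc_to_root V E r x v" if x: "{x, v} \<in> E" "x \<noteq> w" for x
    proof -
      have "x \<notin> set p"
      proof
        assume "x \<in> set p"
        then obtain ys zs where ys: "p = ys @ x # zs" by (meson split_list)
        have "graph_path V E ((v # w # ys @ [x]) @ zs)" using p ys by simp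
        then have "graph_path V E (v # w # ys @ [x])"
          unfolding graph_path_append by (auto split: if_splits)
        then have "graph_cycle V E (v # w # ys @ [x])" using x by (simp add: graph_cycle_def)
        then show False using assms by (auto simp: tree_on_def)
      qed
      then have "graph_path V E (x # v # w # p)"
        using p x nbr[OF x(1)] by (simp add: graph_path_def)
      then show ?thesis using p unfolding arc_to_root_def by (intro exI[of _ "w # p"]) simp
    qed
    ultimately have "{x. arc_to_root V E r x v} = {x. {x, v} \<in> E} - {w}"
      using arc_edge by blast
    then show ?thesis
      using False vw by (simp add: in_degree_to_root_def degree_in_eq_card_neighbours[OF sg]
          card_Diff_singleton insert_commute)
  qed
qed

section \<open>The tree sums as sums over words\<close>

lemma tree_sum_eq_sum_lists:
  assumes "n \<ge> 2"
  shows "tree_sum n x =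
    (\<Sum>xs | set xs \<subseteq> {1..n} \<and> length xs = n - 2. \<Prod>i\<in>{1..n}. x (1 + count_list xs i))"
  using sum_trees_degrees[of "{1..n}" "n - 2" "\<lambda>_. x"] assms by (simp add: tree_sum_def)

lemma rooted_tree_sum_eq_sum_lists:
  assumes "n \<ge> 1"
  shows "rooted_tree_sum n x =
    (\<Sum>xs | set xs \<subseteq> {1..n} \<and> length xs = n - 1. \<Prod>i\<in>{1..n}. x (count_list xs i))"
proof (cases "n = 1")
  \<comment> \<open>Here \<open>n - 2\<close> is truncated, so \<open>sum_trees_degrees\<close> does
    not apply.\<close>
  case True
  have "rooted_trees_on {1..n} = {({}, 1)}"
    using True by (auto simp: rooted_trees_on_def tree_on_singleton)
  moreover have "in_degree_to_root {Suc 0} {} (Suc 0) (Suc 0) = 0"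
    by (simp add: in_degree_to_root_def arc_to_root_def graph_path_def)
  moreover have "{xs. set xs \<subseteq> {1..n} \<and> length xs = n - 1} = {[]}" using True by auto
  ultimately show ?thesis using True by (simp add: rooted_tree_sum_def)
next
  case False
  define V where "V = {1..n}"
  define m where "m = n - 2"
  have V: "finite V" "card V = m + 2" and n: "n - 1 = Suc m"
    using False assms by (auto simp: V_def m_def)
  let ?w = "\<lambda>r v d. x (if v = r then d else d - 1)"
  have "rooted_tree_sum n x =
      (\<Sum>(E, r)\<in>trees_on V \<times> V. \<Prod>v\<in>V. x (in_degree_to_root V E r v))"
    unfolding rooted_tree_sum_def V_def
    by (intro sum.cong) (auto simp: rooted_trees_on_def trees_on_def)
  also have "\<dots> = (\<Sum>E\<in>trees_on V. \<Sum>r\<in>V. \<Prod>v\<in>V. ?w r v (degree_in E v))"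
    unfolding sum.cartesian_product[symmetric]
    by (intro sum.cong prod.cong refl) (simp add: in_degree_to_root_eq trees_on_def)
  also have "\<dots> = (\<Sum>r\<in>V. \<Sum>E\<in>trees_on V. \<Prod>v\<in>V. ?w r v (degree_in E v))"
    by (rule sum.swap)
  also have "\<dots> = (\<Sum>r\<in>V. \<Sum>xs | set xs \<subseteq> V \<and> length xs = m.
      \<Prod>v\<in>V. ?w r v (Suc (count_list xs v)))"
    by (rule sum.cong[OF refl]) (rule sum_trees_degrees[OF V, of "?w r" for r])
  \<comment> \<open>\<open>Suc (count_list xs v)\<close>, lowered by one unless
    \<open>v = r\<close>, is \<open>count_list (r # xs) v\<close>.\<close>
  also have "\<dots> = (\<Sum>xs | set xs \<subseteq> V \<and> length xs = m. \<Sum>r\<in>V.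
      \<Prod>v\<in>V. x (count_list (r # xs) v))"
    by (subst sum.swap) (auto intro!: sum.cong prod.cong)
  also have "\<dots> = (\<Sum>xs | set xs \<subseteq> V \<and> length xs = Suc m. \<Prod>v\<in>V. x (count_list xs v))"
    by (rule sum_lists_length_Suc[symmetric])
  finally show ?thesis unfolding V_def n .
qed

theorem proposition3:
  shows "(\<forall>n\<ge>1. rooted_tree_sum n indet
            = (shift_deriv ^^ (n - 1)) (indet 0 ^ n :: 'a::comm_ring_1 polynomial))
       \<and> (\<forall>n\<ge>2. tree_sum n indet
            = (shift_deriv ^^ (n - 2)) (indet 1 ^ n :: 'a polynomial))"
proof (intro conjI allI impI)
  fix n :: nat assume "n \<ge> 1"
  \<comment> \<open>The power is the product over \<open>{1..n}\<close> of a constant family of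
    indeterminates.\<close>
  then show "rooted_tree_sum n indet = (shift_deriv ^^ (n - 1)) (indet 0 ^ n :: 'a polynomial)"
    using shift_deriv_funpow_prod_indet[of "{1..n}" "n - 1" "\<lambda>_. 0", where 'a = 'a]
    by (simp add: rooted_tree_sum_eq_sum_lists)
next
  fix n :: nat assume "n \<ge> 2"
  then show "tree_sum n indet = (shift_deriv ^^ (n - 2)) (indet 1 ^ n :: 'a polynomial)"
    using shift_deriv_funpow_prod_indet[of "{1..n}" "n - 2" "\<lambda>_. 1", where 'a = 'a]
    by (simp add: tree_sum_eq_sum_lists)
qed

end
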